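(* For every $\epsilon\in(0,1)$ and every non-uniform pmf $p(x)$ on $\{0,1\}$, there exists $p<\epsilon/2$ (with $p\ge 0$) such that the pair $(p(x),\mathrm{BSC}(p))$ is in the admissible region of $(\mathrm{BEC}(\epsilon),0)$ for the asymptotic average-case model (that is, with shared randomness rate $R=0$).
   Context: $\mathrm{BSC}(p)$ is the binary symmetric channel with crossover probability $p$. $\mathrm{BEC}(\epsilon)$ is the binary erasure channel with erasure probability $\epsilon$. Average-case channel simulation: the goal is to simulate memoryless copies of $p(y|x)$ using memoryless copies of $p(\tilde y|\tilde x)$. $X^n$ is i.i.d. with pmf $p(x)$. The shared randomness $\omega$ is independent of $X^n$ and uniformly distributed on $[1:2^{nR}]$ (so for $R=0$ it is constant, i.e. there is no shared randomness). A simulation code of length $n$ consists of a stochastic encoder $q^{\mathrm{enc}}(\tilde x^n|x^n,\omega)$ and a stochastic decoder $q^{\mathrm{dec}}(y^n|\tilde y^n,\omega)$. It induces the distribution $$q(\tilde x^n,\tilde y^n,y^n|\omega,x^n)=q^{\mathrm{enc}}(\tilde x^n|x^n,\omega)\Big(\prod_{i=1}^n p(\tilde y_i|\tilde x_i)\Big)q^{\mathrm{dec}}(y^n|\tilde y^n,\omega),$$ and $q(x^n,y^n)$ denotes the resulting marginal on $(X^n,Y^n)$. It is an $(n,R,\epsilon')$ average-case simulation code if $\big\|q(x^n,y^n)-\prod_{i=1}^n p(x_i)p(y_i|x_i)\big\|_1\le\epsilon'$, where $\|\cdot\|_1$ is the total variation distance. The pair $(p(x),p(y|x))$ is in the admissible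 region of $(p(\tilde y|\tilde x),R)$ for the asymptotic average-case model if there is a sequence of $(n,R,\epsilon_n)$ average-case simulation codes with $\lim_{n\to\infty}\epsilon_n=0$. *)

theory Defs
  imports "HOL-Probability.Probability"
begin

text \<open>
  A discrete memoryless channel is a Markov kernel \<open>W :: 'a \<Rightarrow> 'b pmf\<close>, and sequences of
  length \<open>n\<close> are lists of length \<open>n\<close>.
\<close>

definition BSC :: "real \<Rightarrow> bool \<Rightarrow> bool pmf" where
  "BSC p x = map_pmf (\<lambda>flip. if flip then \<not> x else x) (bernoulli_pmf p)"

text \<open>The erasure symbol is \<open>None\<close>.\<close>

definition BEC :: "real \<Rightarrow> bool \<Rightarrow> bool option pmf" where
  "BEC \<epsilon> x = map_pmf (\<lambda>erase. if erase then None else Some x) (bernoulli_pmf \<epsilon>)"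

primrec memoryless :: "('a \<Rightarrow> 'b pmf) \<Rightarrow> 'a list \<Rightarrow> 'b list pmf" where
  "memoryless W [] = return_pmf []"
| "memoryless W (x # xs) =
     do { y \<leftarrow> W x; ys \<leftarrow> memoryless W xs; return_pmf (y # ys) }"

text \<open>The total variation distance is normalised to take values in \<open>[0, 1]\<close>.\<close>

definition tv_dist :: "'a pmf \<Rightarrow> 'a pmf \<Rightarrow> real" where
  "tv_dist p q = (\<Sum>\<^sub>\<infinity>z. \<bar>pmf p z - pmf q z\<bar>) / 2"

definition target_dist ::
  "'x pmf \<Rightarrow> ('x \<Rightarrow> 'y pmf) \<Rightarrow> nat \<Rightarrow> ('x list \<times> 'y list) pmf" where
  "target_dist P V n =
     do { xs \<leftarrow> replicate_pmf n P; ys \<leftarrow> memoryless V xs; return_pmf (xs, ys) }"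

text \<open>
  For \<open>R \<ge> 0\<close> this set is nonempty; \<open>2 powr (n R)\<close> is rounded down when it is not an integer.
\<close>

definition shared_randomness :: "nat \<Rightarrow> real \<Rightarrow> nat set" where
  "shared_randomness n R = {1..nat \<lfloor>2 powr (real n * R)\<rfloor>}"

definition induced_dist ::
  "'x pmf \<Rightarrow> ('xt \<Rightarrow> 'yt pmf) \<Rightarrow> nat \<Rightarrow> real
   \<Rightarrow> ('x list \<Rightarrow> nat \<Rightarrow> 'xt list pmf) \<Rightarrow> ('yt list \<Rightarrow> nat \<Rightarrow> 'y list pmf)
   \<Rightarrow> ('x list \<times> 'y list) pmf" where
  "induced_dist P W n R enc dec =
     do { xs \<leftarrow> replicate_pmf n P;
          \<omega> \<leftarrow> pmf_of_set (shared_randomness n R);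
          xts \<leftarrow> enc xs \<omega>;
          yts \<leftarrow> memoryless W xts;
          ys \<leftarrow> dec yts \<omega>;
          return_pmf (xs, ys) }"

text \<open>
  The first two conjuncts say that encoder and decoder are kernels between sequences of
  length \<open>n\<close>; in particular the channel \<open>W\<close> is used exactly \<open>n\<close> times.
\<close>

definition avg_simulation_code ::
  "'x pmf \<Rightarrow> ('x \<Rightarrow> 'y pmf) \<Rightarrow> ('xt \<Rightarrow> 'yt pmf) \<Rightarrow> nat \<Rightarrow> real \<Rightarrow> real
   \<Rightarrow> ('x list \<Rightarrow> nat \<Rightarrow> 'xt list pmf) \<Rightarrow> ('yt list \<Rightarrow> nat \<Rightarrow> 'y list pmf) \<Rightarrow> bool" where
  "avg_simulation_code P V W n R \<delta> enc dec \<longleftrightarrow>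
     (\<forall>xs. length xs = n \<longrightarrow>
        (\<forall>\<omega>\<in>shared_randomness n R. set_pmf (enc xs \<omega>) \<subseteq> {xts. length xts = n})) \<and>
     (\<forall>yts. length yts = n \<longrightarrow>
        (\<forall>\<omega>\<in>shared_randomness n R. set_pmf (dec yts \<omega>) \<subseteq> {ys. length ys = n})) \<and>
     tv_dist (induced_dist P W n R enc dec) (target_dist P V n) \<le> \<delta>"

definition avg_admissible ::
  "'x pmf \<Rightarrow> ('x \<Rightarrow> 'y pmf) \<Rightarrow> ('xt \<Rightarrow> 'yt pmf) \<Rightarrow> real \<Rightarrow> bool" where
  "avg_admissible P V W R \<longleftrightarrow>
     (\<exists>\<delta> :: nat \<Rightarrow> real. \<delta> \<longlonglongrightarrow> 0 \<and>
        (\<forall>n\<ge>1. \<exists>enc dec. avg_simulation_code P V W n R (\<delta> n) enc dec))"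

lemma pmf_memoryless:
  "pmf (memoryless W xs) ys =
     (if length ys = length xs then \<Prod>i<length xs. pmf (W (xs ! i)) (ys ! i) else 0)"
proof (induction xs arbitrary: ys)
  case Nil
  then show ?case by (auto simp: pmf_return)
next
  case (Cons x xs)
  have eq: "memoryless W (x # xs) =
      map_pmf (\<lambda>(y, ys). y # ys) (pair_pmf (W x) (memoryless W xs))"
    by (simp add: pair_pmf_def map_bind_pmf)
  show ?case
  proof (cases ys)
    case Nil
    have "[] \<notin> set_pmf (memoryless W (x # xs))"
      unfolding eq by auto
    then show ?thesis using Nil by (simp add: set_pmf_iff del: memoryless.simps)
  next
    case ys: (Cons y ys')
    have "inj (\<lambda>(y, ys). y # ys)" by (auto intro!: injI)
    from pmf_map_inj'[OF this, of "pair_pmf (W x) (memoryless W xs)" "(y, ys')"]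
    have "pmf (memoryless W (x # xs)) ys = pmf (W x) y * pmf (memoryless W xs) ys'"
      unfolding eq ys by (simp add: pmf_pair)
    then show ?thesis
      using Cons.IH[of ys'] ys
      by (simp add: prod.lessThan_Suc_shift del: memoryless.simps prod.lessThan_Suc)
  qed
qed

end

theory Submission
  imports Defs "HOL-Real_Asymp.Real_Asymp"
begin

text \<open>
  Fix the likelier symbol \<open>x0\<close> of the source. Uncoded transmission with a fair guess on erasures
  simulates the channel with crossover probability \<open>\<epsilon> / 2\<close>. Since the source is not uniform, it can
  be used as noise through which a message is sent on top: the encoder transmits \<open>X \<oplus> W(v)\<close>, and the
  decoder recognises \<open>v\<close> because on the unerased positions of the received word \<open>Y'\<close> the
  word \<open>Y' \<oplus> W(v)\<close> differs from \<open>x0\<close>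
  significantly less than half of the time, whereas \<open>Y' \<oplus> W(u)\<close> is uniform for the other words \<open>u\<close>
  of a random codebook \<open>W\<close>. The message \<open>v\<close> reveals each source symbol independently with a small
  probability \<open>\<eta>\<close>; by Hoeffding's inequality it is typically sparse, so messages of
  arbitrarily small rate suffice. Guessing only the erased symbols that were not
  revealed gives a crossover probability \<open>\<epsilon> (1 - \<eta>) / 2\<close>, up to the event of a
  decoding error.
\<close>

subsection \<open>Couplings and product distributions\<close>

text \<open>No summability is assumed: \<open>infsum\<close> of a non-summable function is 0, which
  the bound for the empty set covers.\<close>

lemma infsum_le_bound:
  fixes f :: "'a \<Rightarrow> real"
  assumes "\<And>z. f z \<ge> 0" and "\<And>F. finite F \<Longrightarrow> sum f F \<le> c"
  shows "infsum f UNIV \<le> c"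
proof (cases "f summable_on UNIV")
  case True
  then show ?thesis using assms(2) by (intro infsum_le_finite_sums) auto
next
  case False
  then show ?thesis using assms(2)[of "{}"] by (simp add: infsum_not_exists)
qed

text \<open>Coupling inequality: both laws are images of the same random \<open>w\<close>, so the
  masses at \<open>z\<close> differ only through the parts of the preimages inside the disagreement
  set. Summing over \<open>z\<close> counts that set at most twice, and the normalisation of
  \<open>tv_dist\<close> removes the factor 2.\<close>

lemma tv_dist_coupling:
  "tv_dist (map_pmf f D) (map_pmf g D) \<le> measure_pmf.prob D {w. f w \<noteq> g w}"
proof -
  let ?B = "{w. f w \<noteq> g w}"
  have diff: "\<bar>pmf (map_pmf f D) z - pmf (map_pmf g D) z\<bar> \<le>
      measure_pmf.prob D (f -` {z} \<inter> ?B) + measure_pmf.prob D (g -` {z} \<inter> ?B)" for z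
  proof -
    have split: "measure_pmf.prob D (h -` {z}) =
        measure_pmf.prob D (h -` {z} \<inter> ?B) + measure_pmf.prob D (h -` {z} - ?B)" for h :: "'b \<Rightarrow> 'a"
      using measure_pmf.finite_measure_Union[of "h -` {z} \<inter> ?B" D "h -` {z} - ?B"]
      by (simp add: Int_Diff_Un Int_Diff_disjoint)
    have "f -` {z} - ?B = g -` {z} - ?B" by auto
    then show ?thesis
      using split[of f] split[of g] by (simp add: pmf_map abs_le_iff)
  qed
  have part: "(\<Sum>z\<in>F. measure_pmf.prob D (h -` {z} \<inter> ?B)) \<le> measure_pmf.prob D ?B"
    if "finite F" for F and h :: "'b \<Rightarrow> 'a"
  proof -
    have "(\<Sum>z\<in>F. measure_pmf.prob D (h -` {z} \<inter> ?B)) =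
        measure_pmf.prob D (\<Union>z\<in>F. h -` {z} \<inter> ?B)"
      using that by (intro measure_pmf.finite_measure_finite_Union[symmetric])
        (auto simp: disjoint_family_on_def)
    also have "\<dots> \<le> measure_pmf.prob D ?B"
      by (intro measure_pmf.finite_measure_mono) auto
    finally show ?thesis .
  qed
  have "(\<Sum>\<^sub>\<infinity>z. \<bar>pmf (map_pmf f D) z - pmf (map_pmf g D) z\<bar>) \<le> 2 * measure_pmf.prob D ?B"
  proof (rule infsum_le_bound)
    fix F :: "'a set" assume "finite F"
    have "(\<Sum>z\<in>F. \<bar>pmf (map_pmf f D) z - pmf (map_pmf g D) z\<bar>) \<le>
        (\<Sum>z\<in>F. measure_pmf.prob D (f -` {z} \<inter> ?B)) + (\<Sum>z\<in>F. measure_pmf.prob D (g -` {z} \<inter> ?B))"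
      unfolding sum.distrib[symmetric] by (intro sum_mono diff)
    also have "\<dots> \<le> 2 * measure_pmf.prob D ?B"
      using part[OF \<open>finite F\<close>, of f] part[OF \<open>finite F\<close>, of g] by simp
    finally show "(\<Sum>z\<in>F. \<bar>pmf (map_pmf f D) z - pmf (map_pmf g D) z\<bar>) \<le> 2 * measure_pmf.prob D ?B" .
  qed simp
  then show ?thesis by (simp add: tv_dist_def)
qed

lemma prob_bind_pmf:
  "measure_pmf.prob (bind_pmf M N) S = measure_pmf.expectation M (\<lambda>x. measure_pmf.prob (N x) S)"
proof -
  have "ennreal (measure_pmf.prob (bind_pmf M N) S) = (\<integral>\<^sup>+x. ennreal (measure_pmf.prob (N x) S) \<partial>M)"
    by (simp add: measure_pmf.emeasure_eq_measure[symmetric])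
  also have "\<dots> = ennreal (measure_pmf.expectation M (\<lambda>x. measure_pmf.prob (N x) S))"
    by (intro nn_integral_eq_integral measure_pmf.integrable_const_bound[where B = 1]) auto
  finally show ?thesis by (simp add: integral_nonneg_AE)
qed

lemma prob_bind_pmf_le:
  assumes "\<And>x. x \<in> set_pmf M \<Longrightarrow> measure_pmf.prob (N x) S \<le> c"
  shows "measure_pmf.prob (bind_pmf M N) S \<le> c"
  unfolding prob_bind_pmf
  by (intro measure_pmf.integral_le_const measure_pmf.integrable_const_bound[where B = 1])
    (auto simp: AE_measure_pmf_iff assms)

text \<open>The averaging step of random coding: some outcome does no worse than the mean. Its
  version for \<open>pair_pmf\<close> later fixes one deterministic codebook.\<close>

lemma exists_prob_le_prob_bind_pmf:
  "\<exists>x\<in>set_pmf M. measure_pmf.prob (N x) S \<le> measure_pmf.prob (bind_pmf M N) S"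
proof (rule ccontr)
  assume "\<not> ?thesis"
  then have "measure_pmf.prob (bind_pmf M N) S <
      measure_pmf.expectation M (\<lambda>x. measure_pmf.prob (N x) S)"
    by (intro measure_pmf.expectation_greater measure_pmf.integrable_const_bound[where B = 1])
      (auto simp: AE_measure_pmf_iff)
  then show False by (simp add: prob_bind_pmf)
qed

lemma prob_pair_pmf_le:
  assumes "\<And>b. b \<in> set_pmf B \<Longrightarrow> measure_pmf.prob A {a. (a, b) \<in> S} \<le> c"
  shows "measure_pmf.prob (pair_pmf A B) S \<le> c"
proof -
  have "pair_pmf A B = bind_pmf B (\<lambda>b. map_pmf (\<lambda>a. (a, b)) A)"
    unfolding pair_pmf_def map_pmf_def by (rule bind_commute_pmf)
  then show ?thesis
    using assms by (simp add: prob_bind_pmf_le vimage_def)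
qed

lemma exists_prob_le_prob_pair_pmf:
  "\<exists>a\<in>set_pmf A. measure_pmf.prob B {b. (a, b) \<in> S} \<le> measure_pmf.prob (pair_pmf A B) S"
proof -
  have "pair_pmf A B = bind_pmf A (\<lambda>a. map_pmf (\<lambda>b. (a, b)) B)"
    by (simp add: pair_pmf_def map_pmf_def)
  then show ?thesis
    using exists_prob_le_prob_bind_pmf[of A "\<lambda>a. map_pmf (\<lambda>b. (a, b)) B" S] by (simp add: vimage_def)
qed

lemma length_replicate_pmf: "xs \<in> set_pmf (replicate_pmf n p) \<Longrightarrow> length xs = n"
  by (simp add: set_replicate_pmf)

lemma map_pair_replicate_pmf:
  "map_pmf (\<lambda>(as, bs). map2 h as bs) (pair_pmf (replicate_pmf n A) (replicate_pmf n B)) =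
    replicate_pmf n (map_pmf (\<lambda>(a, b). h a b) (pair_pmf A B))"
proof (induction n)
  case 0
  then show ?case by simp
next
  case (Suc n)
  have "map_pmf (\<lambda>(as, bs). map2 h as bs) (pair_pmf (replicate_pmf (Suc n) A) (replicate_pmf (Suc n) B)) =
     do {a \<leftarrow> A; as \<leftarrow> replicate_pmf n A; b \<leftarrow> B; bs \<leftarrow> replicate_pmf n B; return_pmf (h a b # map2 h as bs)}"
    by (simp add: pair_pmf_def map_bind_pmf bind_assoc_pmf bind_return_pmf)
  also have "\<dots> = do {a \<leftarrow> A; b \<leftarrow> B; as \<leftarrow> replicate_pmf n A; bs \<leftarrow> replicate_pmf n B; return_pmf (h a b # map2 h as bs)}"
    by (subst bind_commute_pmf) simp
  also have "\<dots> = do {c \<leftarrow> map_pmf (\<lambda>(a, b). h a b) (pair_pmf A B);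
      cs \<leftarrow> map_pmf (\<lambda>(as, bs). map2 h as bs) (pair_pmf (replicate_pmf n A) (replicate_pmf n B));
      return_pmf (c # cs)}"
    by (simp add: pair_pmf_def map_bind_pmf bind_map_pmf bind_assoc_pmf bind_return_pmf)
  finally show ?case using Suc by simp
qed

text \<open>Fresh noise drawn for each letter can be absorbed into the channel, because draws for
  the head commute with draws for the tail. Applied stage by stage, this collapses a concatenation
  of channels into one letterwise kernel.\<close>

lemma memoryless_bind:
  "bind_pmf (replicate_pmf (length xs) C) (\<lambda>cs. memoryless W (map2 h xs cs)) =
    memoryless (\<lambda>x. bind_pmf C (\<lambda>c. W (h x c))) xs"
proof (induction xs)
  case (Cons x xs)
  have "bind_pmf (replicate_pmf (length (x # xs)) C) (\<lambda>cs. memoryless W (map2 h (x # xs) cs)) =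
    do {c \<leftarrow> C; cs \<leftarrow> replicate_pmf (length xs) C; y \<leftarrow> W (h x c);
        ys \<leftarrow> memoryless W (map2 h xs cs); return_pmf (y # ys)}"
    by (simp add: bind_assoc_pmf bind_return_pmf)
  also have "\<dots> = do {c \<leftarrow> C; y \<leftarrow> W (h x c); cs \<leftarrow> replicate_pmf (length xs) C;
        ys \<leftarrow> memoryless W (map2 h xs cs); return_pmf (y # ys)}"
    by (subst (2) bind_commute_pmf) simp
  also have "\<dots> = do {y \<leftarrow> C \<bind> (\<lambda>c. W (h x c));
        ys \<leftarrow> replicate_pmf (length xs) C \<bind> (\<lambda>cs. memoryless W (map2 h xs cs)); return_pmf (y # ys)}"
    by (simp add: bind_assoc_pmf bind_return_pmf)
  finally show ?case using Cons by simp
qed (simp add: bind_return_pmf)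

lemma memoryless_return_pmf: "memoryless return_pmf xs = return_pmf xs"
  by (induction xs) (simp_all add: bind_return_pmf)

lemma memoryless_map:
  "memoryless (\<lambda>x. map_pmf (h x) C) xs = map_pmf (map2 h xs) (replicate_pmf (length xs) C)"
  unfolding map_pmf_def memoryless_bind[symmetric] memoryless_return_pmf ..

subsection \<open>Random binary words\<close>

lemma bool_pmf_eq_bernoulli: "M = bernoulli_pmf (pmf M True)" for M :: "bool pmf"
proof (rule pmf_eqI)
  fix b
  have "pmf M True + pmf M False = sum (pmf M) UNIV" by (simp add: UNIV_bool)
  also have "\<dots> = 1" by (rule sum_pmf_eq_1) auto
  finally have "pmf M True + pmf M False = 1" .
  then show "pmf M b = pmf (bernoulli_pmf (pmf M True)) b"
    by (cases b) (simp_all add: pmf_le_1)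
qed

text \<open>Hoeffding's inequality, as the number of \<open>True\<close> entries of an i.i.d. word
  is binomial.\<close>

lemma replicate_bool_pmf_upper_tail:
  fixes M :: "bool pmf"
  assumes "n > 0" "t \<ge> 0"
  shows "measure_pmf.prob (replicate_pmf n M) {bs. real n * (pmf M True + t) \<le> real (length (filter id bs))}
    \<le> exp (- 2 * real n * t\<^sup>2)"
proof -
  interpret binomial_distribution n "pmf M True" by unfold_locales (simp add: pmf_le_1)
  have "binomial_pmf n (pmf M True) = map_pmf (length \<circ> filter id) (replicate_pmf n M)"
    by (subst binomial_pmf_altdef) (simp_all add: pmf_le_1 flip: bool_pmf_eq_bernoulli)
  with prob_ge'[OF assms] show ?thesis
    using assms by (simp add: vimage_def field_simps)
qed

lemma replicate_bool_pmf_lower_tail: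
  fixes M :: "bool pmf"
  assumes "n > 0" "t \<ge> 0"
  shows "measure_pmf.prob (replicate_pmf n M) {bs. real (length (filter id bs)) \<le> real n * (pmf M True - t)}
    \<le> exp (- 2 * real n * t\<^sup>2)"
proof -
  interpret binomial_distribution n "pmf M True" by unfold_locales (simp add: pmf_le_1)
  have "binomial_pmf n (pmf M True) = map_pmf (length \<circ> filter id) (replicate_pmf n M)"
    by (subst binomial_pmf_altdef) (simp_all add: pmf_le_1 flip: bool_pmf_eq_bernoulli)
  with prob_le'[OF assms] show ?thesis
    using assms by (simp add: vimage_def field_simps)
qed

lemma map_xor_uniform:
  assumes "length as = n"
  shows "map_pmf (\<lambda>w. map2 (\<noteq>) as w) (replicate_pmf n (bernoulli_pmf (1/2))) =
    replicate_pmf n (bernoulli_pmf (1/2))"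
  using assms
proof (induction n arbitrary: as)
  case (Suc n)
  then obtain a as' where as: "as = a # as'" "length as' = n" by (cases as) auto
  have flip: "map_pmf (\<lambda>b. a \<noteq> b) (bernoulli_pmf (1/2)) = bernoulli_pmf (1/2)"
    unfolding bernoulli_pmf_half_conv_pmf_of_set
    by (intro map_pmf_of_set_bij_betw) (auto simp: bij_betw_def inj_on_def)
  have "map_pmf (\<lambda>w. map2 (\<noteq>) as w) (replicate_pmf (Suc n) (bernoulli_pmf (1/2))) =
     do {b \<leftarrow> map_pmf (\<lambda>b. a \<noteq> b) (bernoulli_pmf (1/2));
         bs \<leftarrow> map_pmf (\<lambda>w. map2 (\<noteq>) as' w) (replicate_pmf n (bernoulli_pmf (1/2)));
         return_pmf (b # bs)}"
    by (simp add: as map_bind_pmf bind_map_pmf)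
  then show ?case by (simp only: flip Suc.IH[OF as(2)] replicate_pmf.simps)
qed simp

text \<open>One-time pad: given all other codewords, \<open>W v\<close> is still uniform, and xor
  with the then fixed word \<open>W u\<close> preserves uniformity.\<close>

lemma map_xor_Pi_uniform:
  fixes d :: "bool list" and n :: nat
  assumes "finite A" "u \<in> A" "v \<in> A" "u \<noteq> v"
  defines "U \<equiv> replicate_pmf n (bernoulli_pmf (1/2))"
  shows "map_pmf (\<lambda>W. map2 (\<noteq>) (W u) (W v)) (Pi_pmf A d (\<lambda>_. U)) = U"
proof -
  let ?A = "A - {v}"
  have A: "A = insert v ?A" using assms by auto
  have "map_pmf (\<lambda>W. map2 (\<noteq>) (W u) (W v)) (Pi_pmf A d (\<lambda>_. U)) =
    bind_pmf (Pi_pmf ?A d (\<lambda>_. U)) (\<lambda>f. map_pmf (\<lambda>w. map2 (\<noteq>) (f u) w) U)"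
    using assms
    by (subst A, subst Pi_pmf_insert', simp_all add: map_bind_pmf map_pmf_def bind_assoc_pmf bind_return_pmf)
      (subst bind_commute_pmf, simp)
  also have "\<dots> = bind_pmf (Pi_pmf ?A d (\<lambda>_. U)) (\<lambda>_. U)"
  proof (rule bind_pmf_cong[OF refl])
    fix f assume "f \<in> set_pmf (Pi_pmf ?A d (\<lambda>_. U))"
    then have "f u \<in> set_pmf U"
      using assms by (subst (asm) set_Pi_pmf) (auto simp: PiE_dflt_def)
    then show "map_pmf (\<lambda>w. map2 (\<noteq>) (f u) w) U = U"
      unfolding U_def by (intro map_xor_uniform) (rule length_replicate_pmf)
  qed
  finally show ?thesis by simp
qed

subsection \<open>Sparse messages and the random codebook\<close>

definition reveal :: "bool list \<Rightarrow> bool list \<Rightarrow> bool option list" where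
  "reveal xs cs = map2 (\<lambda>x c. if c then Some x else None) xs cs"

definition erase :: "'a list \<Rightarrow> bool list \<Rightarrow> 'a option list" where
  "erase zs es = map2 (\<lambda>z e. if e then None else Some z) zs es"

text \<open>The statistic of the decoder. Erased positions never count, so the number of
  \<open>True\<close> entries concentrates near
  \<open>n * (1 - \<epsilon>) * pmf P (\<not> x0)\<close> for the true codeword and near
  \<open>n * (1 - \<epsilon>) / 2\<close> for another random one.\<close>

definition mismatches :: "bool \<Rightarrow> bool option list \<Rightarrow> bool list \<Rightarrow> bool list" where
  "mismatches x0 yts w = map2 (\<lambda>y b. case y of None \<Rightarrow> False | Some c \<Rightarrow> (c \<noteq> b) \<noteq> x0) yts w"

text \<open>The strict inequality makes non-membership, for words of length \<open>n\<close>,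
  exactly the kind of tail event that Hoeffding's inequality bounds.\<close>

definition sparse :: "nat \<Rightarrow> real \<Rightarrow> 'a option list set" where
  "sparse n \<theta> = {v. length v = n \<and> real (length (filter (\<lambda>y. y \<noteq> None) v)) < real n * \<theta>}"

text \<open>The number \<open>k\<close> is the decoding threshold; the middle disjunct says that the true message fails it.\<close>

definition decoding_error ::
  "bool \<Rightarrow> bool option list set \<Rightarrow> real \<Rightarrow> (bool option list \<Rightarrow> bool list)
    \<Rightarrow> bool list \<Rightarrow> bool list \<Rightarrow> bool list \<Rightarrow> bool" where
  "decoding_error x0 T k W xs cs es \<longleftrightarrow>
    (let v = reveal xs cs; yts = erase (map2 (\<noteq>) xs (W v)) es in
      v \<notin> T \<or> k \<le> real (length (filter id (mismatches x0 yts (W v)))) \<or>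
      (\<exists>u\<in>T. u \<noteq> v \<and> real (length (filter id (mismatches x0 yts (W u)))) \<le> k))"

lemma length_reveal [simp]: "length (reveal xs cs) = min (length xs) (length cs)"
  by (simp add: reveal_def)

lemma length_erase [simp]: "length (erase zs es) = min (length zs) (length es)"
  by (simp add: erase_def)

lemma finite_sparse: "finite (sparse n \<theta> :: 'a::finite option list set)"
proof -
  have "finite {v :: 'a option list. set v \<subseteq> UNIV \<and> length v = n}"
    by (rule finite_lists_length_eq) simp
  then show ?thesis by (rule rev_finite_subset) (auto simp: sparse_def)
qed

text \<open>Generating function of the weight: each position contributes 1 for \<open>None\<close>
  and \<open>l\<close> for each of the two revealed values.\<close>

lemma sum_power_weight:
  fixes l :: real
  shows "(\<Sum>v | length v = n. l ^ length (filter (\<lambda>y. y \<noteq> (None :: bool option)) v)) = (1 + 2 * l) ^ n"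
proof (induction n)
  case 0
  have "{v :: bool option list. length v = 0} = {[]}" by auto
  then show ?case by simp
next
  case (Suc n)
  let ?w = "\<lambda>v. l ^ length (filter (\<lambda>y. y \<noteq> (None :: bool option)) v)"
  have "{v :: bool option list. length v = Suc n} = (\<lambda>(a, v). a # v) ` (UNIV \<times> {v. length v = n})"
    by (auto simp: length_Suc_conv image_iff)
  then have "(\<Sum>v | length v = Suc n. ?w v) = (\<Sum>(a, v) \<in> UNIV \<times> {v. length v = n}. ?w (a # v))"
    by (simp add: sum.reindex inj_on_def case_prod_unfold)
  also have "\<dots> = (\<Sum>a\<in>UNIV. \<Sum>v | length v = n. ?w (a # v))"
    by (rule sum.cartesian_product[symmetric])
  also have "\<dots> = (\<Sum>v | length v = n. ?w v) * (1 + 2 * l)"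
    by (simp add: UNIV_option_conv UNIV_bool ex_bool_eq sum_distrib_left[symmetric] algebra_simps)
  finally show ?case using Suc by simp
qed

text \<open>Chernoff-style counting: since \<open>l \<le> 1\<close>, every sparse word contributes
  at least \<open>l powr (n * \<theta>)\<close> to the generating function.\<close>

lemma card_sparse_le:
  assumes "0 < l" "l \<le> 1"
  shows "real (card (sparse n \<theta> :: bool option list set)) * l powr (real n * \<theta>) \<le> (1 + 2 * l) ^ n"
proof -
  let ?w = "\<lambda>v. length (filter (\<lambda>y. y \<noteq> (None :: bool option)) v)"
  have fin: "finite {v :: bool option list. length v = n}"
    using finite_lists_length_eq[of "UNIV :: bool option set" n] by simp
  have "real (card (sparse n \<theta> :: bool option list set)) * l powr (real n * \<theta>) =
      (\<Sum>v\<in>(sparse n \<theta> :: bool option list set). l powr (real n * \<theta>))"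
    by simp
  also have "\<dots> \<le> (\<Sum>v\<in>sparse n \<theta>. l ^ ?w v)"
  proof (rule sum_mono)
    fix v :: "bool option list" assume "v \<in> sparse n \<theta>"
    then have "l powr (real n * \<theta>) \<le> l powr real (?w v)"
      using assms by (intro powr_mono') (auto simp: sparse_def)
    then show "l powr (real n * \<theta>) \<le> l ^ ?w v" using assms by (simp add: powr_realpow)
  qed
  also have "\<dots> \<le> (\<Sum>v | length v = n. l ^ ?w v)"
    using assms by (intro sum_mono2 fin) (auto simp: sparse_def)
  finally show ?thesis by (simp only: sum_power_weight)
qed

lemma exists_small_sparse:
  assumes "0 < c" "c \<le> 1"
  shows "\<exists>\<theta>>0. \<theta> < 2 \<and> (\<forall>n. real (card (sparse n \<theta> :: bool option list set)) \<le> exp (real n * c))"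
proof -
  \<comment> \<open>This \<open>l\<close> makes \<open>(1 + 2 * l) ^ n\<close> at most
    \<open>exp (n * c / 2)\<close>, and \<open>\<theta>\<close> is such that dividing by
    \<open>l powr (n * \<theta>)\<close> costs at most the same factor again. The cap 1 keeps
    \<open>\<theta>\<close> below 2, so that half of it can later serve as a probability.\<close>
  define l where "l = c / 4"
  define \<theta> where "\<theta> = min 1 (c / (2 * ln (1 / l)))"
  have l: "0 < l" "l < 1" using assms by (auto simp: l_def)
  then have "ln (1 / l) > 0" by simp
  then have \<theta>: "\<theta> > 0" "\<theta> * ln (1 / l) \<le> c / 2"
    using assms by (auto simp: \<theta>_def min_def field_simps)
  have "real (card (sparse n \<theta> :: bool option list set)) \<le> exp (real n * c)" for n
  proof -
    have "(1 + 2 * l) ^ n \<le> exp (2 * l) ^ n"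
      using l by (intro power_mono) auto
    also have "\<dots> = exp (real n * (c / 2))" by (subst exp_of_nat_mult) (simp add: l_def)
    finally have "real (card (sparse n \<theta> :: bool option list set)) * l powr (real n * \<theta>) \<le> exp (real n * (c / 2))"
      using card_sparse_le[of l n \<theta>] l by linarith
    moreover have "exp (- (real n * (c / 2))) \<le> l powr (real n * \<theta>)"
    proof -
      have "real n * (\<theta> * ln (1 / l)) \<le> real n * (c / 2)" by (intro mult_left_mono \<theta>) auto
      then show ?thesis using l by (simp add: powr_def ln_div algebra_simps)
    qed
    ultimately have "real (card (sparse n \<theta> :: bool option list set)) * exp (- (real n * (c / 2))) \<le> exp (real n * (c / 2))"
      by (meson mult_left_mono of_nat_0_le_iff order_trans)
    then have "real (card (sparse n \<theta> :: bool option list set)) \<le> exp (real n * (c / 2)) * exp (real n * (c / 2))"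
      by (simp add: exp_minus field_simps)
    then show ?thesis by (simp add: mult.commute flip: exp_add)
  qed
  then show ?thesis using \<theta>(1) by (intro exI[of _ \<theta>]) (auto simp: \<theta>_def)
qed

section \<open>Mismatch counts and the probability of a decoding error\<close>

lemma mismatches_erase_xor:
  assumes "length w = length xs" "length u = length xs" "length es = length xs"
  shows "mismatches x0 (erase (map2 (\<noteq>) xs w) es) u =
    map2 (\<lambda>z e. z \<noteq> x0 \<and> \<not> e) (map2 (\<noteq>) xs (map2 (\<noteq>) w u)) es"
  using assms by (intro nth_equalityI) (auto simp: mismatches_def erase_def)

lemma mismatches_erase_self:
  assumes "length w = length xs" "length es = length xs"
  shows "mismatches x0 (erase (map2 (\<noteq>) xs w) es) w = map2 (\<lambda>x e. x \<noteq> x0 \<and> \<not> e) xs es"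
  using assms by (intro nth_equalityI) (auto simp: mismatches_def erase_def)

lemma weight_reveal:
  assumes "length cs = length xs"
  shows "length (filter (\<lambda>y. y \<noteq> None) (reveal xs cs)) = length (filter id cs)"
  using assms by (induction cs xs rule: list_induct2) (auto simp: reveal_def)

text \<open>Used with the source law for the true codeword and with fair bits for a wrong
  one.\<close>

lemma pmf_map_unerased_mismatch:
  assumes "0 \<le> \<epsilon>" "\<epsilon> \<le> 1"
  shows "pmf (map_pmf (\<lambda>(x, e). x \<noteq> x0 \<and> \<not> e) (pair_pmf P (bernoulli_pmf \<epsilon>))) True =
    (1 - \<epsilon>) * pmf P (\<not> x0)"
proof -
  have "(\<lambda>(x, e). x \<noteq> x0 \<and> \<not> e) -` {True} = {(\<not> x0, False)}" by auto
  then have "pmf (map_pmf (\<lambda>(x, e). x \<noteq> x0 \<and> \<not> e) (pair_pmf P (bernoulli_pmf \<epsilon>))) True =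
      pmf (pair_pmf P (bernoulli_pmf \<epsilon>)) (\<not> x0, False)"
    by (simp add: pmf_map measure_pmf_single)
  then show ?thesis using assms by (simp add: pmf_pair)
qed

text \<open>The xor of \<open>W v\<close> and \<open>W u\<close> is uniform and stays so after xor
  with the fixed \<open>xs\<close>. Mismatches are therefore i.i.d. with probability
  \<open>(1 - \<epsilon>) / 2\<close>, and the bound is the lower Hoeffding tail.\<close>

lemma prob_wrong_codeword_le:
  fixes d :: "bool list"
  assumes "0 \<le> \<epsilon>" "\<epsilon> \<le> 1" "n > 0" "t \<ge> 0" "length xs = n"
    and "finite A" "v \<in> A" "u \<in> A" "v \<noteq> u"
  defines "U \<equiv> replicate_pmf n (bernoulli_pmf (1/2))"
  shows "measure_pmf.prob (pair_pmf (Pi_pmf A d (\<lambda>_. U)) (replicate_pmf n (bernoulli_pmf \<epsilon>)))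
      {(W, es). real (length (filter id (mismatches x0 (erase (map2 (\<noteq>) xs (W v)) es) (W u))))
          \<le> real n * ((1 - \<epsilon>) / 2 - t)} \<le> exp (- 2 * real n * t\<^sup>2)"
proof -
  let ?C = "Pi_pmf A d (\<lambda>_. U)" and ?E = "replicate_pmf n (bernoulli_pmf \<epsilon>)"
  let ?M = "map_pmf (\<lambda>(x, e). x \<noteq> x0 \<and> \<not> e) (pair_pmf (bernoulli_pmf (1/2)) (bernoulli_pmf \<epsilon>))"
  let ?S = "{bs. real (length (filter id bs)) \<le> real n * ((1 - \<epsilon>) / 2 - t)}"
  have len: "length (W w) = n" if "W \<in> set_pmf ?C" "w \<in> A" for W w
    using that \<open>finite A\<close> length_replicate_pmf[of "W w" n]
    by (auto simp: set_Pi_pmf PiE_dflt_def U_def)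
  have mm: "mismatches x0 (erase (map2 (\<noteq>) xs (W v)) es) (W u) =
      map2 (\<lambda>z e. z \<noteq> x0 \<and> \<not> e) (map2 (\<noteq>) xs (map2 (\<noteq>) (W v) (W u))) es"
    if "W \<in> set_pmf ?C" "es \<in> set_pmf ?E" for W es
    using that assms(5-9) len length_replicate_pmf[of es n] by (intro mismatches_erase_xor) auto
  have "map_pmf (\<lambda>(W, es). mismatches x0 (erase (map2 (\<noteq>) xs (W v)) es) (W u)) (pair_pmf ?C ?E) =
      map_pmf (\<lambda>(W, es). map2 (\<lambda>z e. z \<noteq> x0 \<and> \<not> e) (map2 (\<noteq>) xs (map2 (\<noteq>) (W v) (W u))) es) (pair_pmf ?C ?E)"
    by (rule map_pmf_cong[OF refl]) (use mm in \<open>simp only: set_pair_pmf mem_Times_iff case_prod_unfold\<close>)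
  also have "\<dots> = map_pmf (\<lambda>(us, es). map2 (\<lambda>z e. z \<noteq> x0 \<and> \<not> e) us es)
      (map_pmf (\<lambda>(W, es). (map2 (\<noteq>) xs (map2 (\<noteq>) (W v) (W u)), es)) (pair_pmf ?C ?E))"
    by (simp add: pmf.map_comp o_def case_prod_unfold)
  also have "map_pmf (\<lambda>(W, es). (map2 (\<noteq>) xs (map2 (\<noteq>) (W v) (W u)), es)) (pair_pmf ?C ?E) =
      pair_pmf (map_pmf (\<lambda>w. map2 (\<noteq>) xs w) (map_pmf (\<lambda>W. map2 (\<noteq>) (W v) (W u)) ?C)) ?E"
    using map_pair[of "\<lambda>W. map2 (\<noteq>) xs (map2 (\<noteq>) (W v) (W u))" "\<lambda>e. e" ?C ?E]
    by (simp add: pmf.map_comp o_def)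
  also have "map_pmf (\<lambda>W. map2 (\<noteq>) (W v) (W u)) ?C = U"
    unfolding U_def using assms(6-9) by (rule map_xor_Pi_uniform)
  also have "map_pmf (\<lambda>w. map2 (\<noteq>) xs w) U = U"
    unfolding U_def using assms(5) by (rule map_xor_uniform)
  also have "map_pmf (\<lambda>(us, es). map2 (\<lambda>z e. z \<noteq> x0 \<and> \<not> e) us es) (pair_pmf U ?E) = replicate_pmf n ?M"
    unfolding U_def by (rule map_pair_replicate_pmf)
  finally have eq: "map_pmf (\<lambda>(W, es). mismatches x0 (erase (map2 (\<noteq>) xs (W v)) es) (W u)) (pair_pmf ?C ?E) =
    replicate_pmf n ?M" .
  have q: "pmf ?M True = (1 - \<epsilon>) / 2"
    using assms by (subst pmf_map_unerased_mismatch) auto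
  have "measure_pmf.prob (replicate_pmf n ?M) ?S \<le> exp (- 2 * real n * t\<^sup>2)"
    using \<open>n > 0\<close> \<open>t \<ge> 0\<close> by (rule replicate_bool_pmf_lower_tail[of n t ?M, unfolded q])
  then show ?thesis
    unfolding eq[symmetric] by (simp add: vimage_def case_prod_unfold)
qed

text \<open>The hypotheses \<open>gap\<close> place the threshold \<open>k\<close> at distance
  \<open>t\<close> from both mean mismatch rates. An error requires that a wrong message of
  \<open>T\<close> passes, that the true one has too many mismatches, or that it is not sparse; the
  three summands bound these events in turn, the first by a union bound.\<close>

lemma prob_decoding_error_le:
  fixes d :: "bool list" and P :: "bool pmf"
  assumes \<epsilon>: "0 \<le> \<epsilon>" "\<epsilon> \<le> 1" and \<eta>: "0 \<le> \<eta>" "\<eta> \<le> 1" and "n > 0" "s \<ge> 0" "t \<ge> 0"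
    and gap: "(1 - \<epsilon>) * pmf P (\<not> x0) + t = k" "k = (1 - \<epsilon>) / 2 - t"
  defines "U \<equiv> replicate_pmf n (bernoulli_pmf (1/2))"
    and "A \<equiv> {v :: bool option list. length v = n}"
    and "T \<equiv> sparse n (\<eta> + s)"
  defines "Xs \<equiv> replicate_pmf n P" and "Cs \<equiv> replicate_pmf n (bernoulli_pmf \<eta>)"
    and "Es \<equiv> replicate_pmf n (bernoulli_pmf \<epsilon>)"
  shows "measure_pmf.prob (pair_pmf (pair_pmf (Pi_pmf A d (\<lambda>_. U)) Es) (pair_pmf Xs Cs))
      {((W, es), (xs, cs)). decoding_error x0 T (real n * k) W xs cs es}
    \<le> real (card T) * exp (- 2 * real n * t\<^sup>2) + exp (- 2 * real n * t\<^sup>2) + exp (- 2 * real n * s\<^sup>2)"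
proof -
  let ?C = "Pi_pmf A d (\<lambda>_. U)"
  let ?Q = "pair_pmf (pair_pmf ?C Es) (pair_pmf Xs Cs)"
  let ?B1 = "{((W, es), (xs, cs)). \<exists>u\<in>T. u \<noteq> reveal xs cs \<and>
      real (length (filter id (mismatches x0 (erase (map2 (\<noteq>) xs (W (reveal xs cs))) es) (W u)))) \<le> real n * k}
      :: (((bool option list \<Rightarrow> bool list) \<times> bool list) \<times> bool list \<times> bool list) set"
  \<comment> \<open>The codeword of the true message cancels, so this event involves only
    \<open>xs\<close> and \<open>es\<close>.\<close>
  let ?B2 = "{((W, es), (xs, cs)). real n * k \<le> real (length (filter id (map2 (\<lambda>x e. x \<noteq> x0 \<and> \<not> e) xs es)))}
      :: (((bool option list \<Rightarrow> bool list) \<times> bool list) \<times> bool list \<times> bool list) set"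
  let ?B3 = "{((W, es), (xs, cs)). real n * (\<eta> + s) \<le> real (length (filter id cs))}
      :: (((bool option list \<Rightarrow> bool list) \<times> bool list) \<times> bool list \<times> bool list) set"
  have finA: "finite A"
    using finite_lists_length_eq[of "UNIV :: bool option set" n] by (simp add: A_def)
  have finT: "finite T" unfolding T_def by (rule finite_sparse)
  have TA: "T \<subseteq> A" by (auto simp: T_def A_def sparse_def)
  have len: "length (W v) = n" if "W \<in> set_pmf ?C" "v \<in> A" for W v
    using that finA length_replicate_pmf[of "W v" n]
    by (auto simp: set_Pi_pmf PiE_dflt_def U_def)
  \<comment> \<open>Conditioning on \<open>xs\<close> and \<open>cs\<close> fixes the message
    \<open>v\<close> independently of the codebook, so that \<open>W v\<close> and
    \<open>W u\<close> are independent uniform words.\<close>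
  have b1: "measure_pmf.prob ?Q ?B1 \<le> real (card T) * exp (- 2 * real n * t\<^sup>2)"
  proof (rule prob_pair_pmf_le)
    fix b assume "b \<in> set_pmf (pair_pmf Xs Cs)"
    then obtain xs cs where b: "b = (xs, cs)" "length xs = n" "length cs = n"
      by (auto simp: Xs_def Cs_def dest: length_replicate_pmf)
    define v where "v = reveal xs cs"
    have v: "v \<in> A" using b by (simp add: v_def A_def)
    let ?S = "\<lambda>u. {(W, es). real (length (filter id (mismatches x0 (erase (map2 (\<noteq>) xs (W v)) es) (W u)))) \<le> real n * k}"
    have "measure_pmf.prob (pair_pmf ?C Es) {a. (a, b) \<in> ?B1} =
        measure_pmf.prob (pair_pmf ?C Es) (\<Union>u\<in>T - {v}. ?S u)"
      by (rule arg_cong[where f = "measure_pmf.prob (pair_pmf ?C Es)"]) (auto simp: b v_def)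
    also have "\<dots> \<le> (\<Sum>u\<in>T - {v}. measure_pmf.prob (pair_pmf ?C Es) (?S u))"
      using finT by (intro measure_pmf.finite_measure_subadditive_finite) auto
    also have "\<dots> \<le> (\<Sum>u\<in>T - {v}. exp (- 2 * real n * t\<^sup>2))"
      unfolding gap(2) U_def Es_def
      using assms(1-9) b v TA finA
      by (intro sum_mono prob_wrong_codeword_le) auto
    also have "\<dots> \<le> real (card T) * exp (- 2 * real n * t\<^sup>2)"
      using finT by (simp add: card_mono)
    finally show "measure_pmf.prob (pair_pmf ?C Es) {a. (a, b) \<in> ?B1} \<le> real (card T) * exp (- 2 * real n * t\<^sup>2)" .
  qed
  have b2: "measure_pmf.prob ?Q ?B2 \<le> exp (- 2 * real n * t\<^sup>2)"
  proof -
    let ?M = "map_pmf (\<lambda>(x, e). x \<noteq> x0 \<and> \<not> e) (pair_pmf P (bernoulli_pmf \<epsilon>))"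
    have "map_pmf (\<lambda>((W, es), (xs, cs)). (es, xs)) ?Q = pair_pmf (map_pmf snd (pair_pmf ?C Es)) (map_pmf fst (pair_pmf Xs Cs))"
      by (subst map_pair[symmetric]) (simp add: case_prod_unfold)
    then have "map_pmf (\<lambda>((W, es), (xs, cs)). (es, xs)) ?Q = pair_pmf Es Xs"
      by (simp add: map_fst_pair_pmf map_snd_pair_pmf)
    then have "map_pmf (\<lambda>(es, xs). map2 (\<lambda>x e. x \<noteq> x0 \<and> \<not> e) xs es) (map_pmf (\<lambda>((W, es), (xs, cs)). (es, xs)) ?Q) =
        map_pmf (\<lambda>(xs, es). map2 (\<lambda>x e. x \<noteq> x0 \<and> \<not> e) xs es) (pair_pmf Xs Es)"
      by (subst pair_commute_pmf) (simp add: pmf.map_comp o_def case_prod_unfold)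
    then have eq: "map_pmf (\<lambda>((W, es), (xs, cs)). map2 (\<lambda>x e. x \<noteq> x0 \<and> \<not> e) xs es) ?Q = replicate_pmf n ?M"
      using map_pair_replicate_pmf[of "\<lambda>x e. x \<noteq> x0 \<and> \<not> e" n P "bernoulli_pmf \<epsilon>"]
      by (simp add: Xs_def Es_def pmf.map_comp o_def case_prod_unfold)
    have "pmf ?M True = (1 - \<epsilon>) * pmf P (\<not> x0)"
      using \<epsilon> by (rule pmf_map_unerased_mismatch)
    then have "measure_pmf.prob (replicate_pmf n ?M) {bs. real n * k \<le> real (length (filter id bs))} \<le> exp (- 2 * real n * t\<^sup>2)"
      using replicate_bool_pmf_upper_tail[of n t ?M] assms(5-9) by simp
    then show ?thesis
      unfolding eq[symmetric] by (simp add: vimage_def case_prod_unfold)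
  qed
  have b3: "measure_pmf.prob ?Q ?B3 \<le> exp (- 2 * real n * s\<^sup>2)"
  proof -
    have eq: "map_pmf (snd \<circ> snd) ?Q = Cs"
      by (simp flip: pmf.map_comp add: map_snd_pair_pmf)
    have "measure_pmf.prob Cs {bs. real n * (\<eta> + s) \<le> real (length (filter id bs))} \<le> exp (- 2 * real n * s\<^sup>2)"
      using replicate_bool_pmf_upper_tail[of n s "bernoulli_pmf \<eta>"] assms(3-7) by (simp add: Cs_def)
    then have "measure_pmf.prob (map_pmf (snd \<circ> snd) ?Q) {bs. real n * (\<eta> + s) \<le> real (length (filter id bs))}
        \<le> exp (- 2 * real n * s\<^sup>2)"
      by (simp only: eq)
    then show ?thesis
      by (simp add: vimage_def case_prod_unfold)
  qed
  \<comment> \<open>The inclusion is shown almost surely, since the words have length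
    \<open>n\<close> on the support only.\<close>
  have "measure_pmf.prob ?Q {((W, es), (xs, cs)). decoding_error x0 T (real n * k) W xs cs es} \<le>
      measure_pmf.prob ?Q (?B1 \<union> ?B2 \<union> ?B3)"
  proof (rule measure_pmf.finite_measure_mono_AE)
    show "AE q in ?Q. q \<in> {((W, es), (xs, cs)). decoding_error x0 T (real n * k) W xs cs es} \<longrightarrow> q \<in> ?B1 \<union> ?B2 \<union> ?B3"
      unfolding AE_measure_pmf_iff
    proof (intro ballI impI)
      fix q assume q: "q \<in> set_pmf ?Q" "q \<in> {((W, es), (xs, cs)). decoding_error x0 T (real n * k) W xs cs es}"
      obtain W es xs cs where q': "q = ((W, es), (xs, cs))" by (metis surj_pair)
      have W: "W \<in> set_pmf ?C" and l: "length xs = n" "length cs = n" "length es = n"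
        using q(1) unfolding q' by (auto simp: Xs_def Cs_def Es_def dest: length_replicate_pmf)
      have "length (W (reveal xs cs)) = n" using len[OF W] l by (simp add: A_def)
      then have m: "mismatches x0 (erase (map2 (\<noteq>) xs (W (reveal xs cs))) es) (W (reveal xs cs)) =
          map2 (\<lambda>x e. x \<noteq> x0 \<and> \<not> e) xs es"
        using l by (intro mismatches_erase_self) auto
      \<comment> \<open>Revealed positions are the \<open>True\<close> entries of \<open>cs\<close>,
        so a message outside \<open>T\<close> is a tail event for \<open>cs\<close>.\<close>
      have "real n * (\<eta> + s) \<le> real (length (filter id cs))" if "reveal xs cs \<notin> T"
        using that l weight_reveal[of cs xs] by (simp add: T_def sparse_def)
      moreover have "decoding_error x0 T (real n * k) W xs cs es" using q(2) by (simp add: q')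
      ultimately show "q \<in> ?B1 \<union> ?B2 \<union> ?B3"
        unfolding decoding_error_def Let_def m q' by auto
    qed
  qed simp
  also have "\<dots> \<le> measure_pmf.prob ?Q ?B1 + measure_pmf.prob ?Q ?B2 + measure_pmf.prob ?Q ?B3"
    using measure_Un_le[of "?B1 \<union> ?B2" "measure_pmf ?Q" ?B3]
      measure_Un_le[of ?B1 "measure_pmf ?Q" ?B2] by simp
  finally show ?thesis using b1 b2 b3 by linarith
qed

subsection \<open>The simulation code\<close>

text \<open>Indexing by the positions of \<open>yts\<close> gives the output the right length even
  when a failed decoding yields \<open>v\<close> or \<open>w\<close> of another length. The word
  \<open>gs\<close> supplies fair guesses.\<close>

definition reconstruct ::
  "bool option list \<Rightarrow> bool list \<Rightarrow> bool option list \<Rightarrow> bool list \<Rightarrow> bool list" where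
  "reconstruct yts w v gs = map (\<lambda>i.
     case yts ! i of Some b \<Rightarrow> b \<noteq> w ! i
     | None \<Rightarrow> (case v ! i of Some b \<Rightarrow> b | None \<Rightarrow> gs ! i)) [0..<length yts]"

text \<open>The choice is arbitrary if no message or several messages pass the threshold; for a
  received word this happens only within the event \<open>decoding_error\<close>.\<close>

definition decode ::
  "bool \<Rightarrow> bool option list set \<Rightarrow> real \<Rightarrow> (bool option list \<Rightarrow> bool list)
    \<Rightarrow> bool option list \<Rightarrow> bool option list" where
  "decode x0 T k W yts = (SOME v. v \<in> T \<and> real (length (filter id (mismatches x0 yts (W v)))) \<le> k)"

lemma decode_eq_reveal:
  assumes "\<not> decoding_error x0 T k W xs cs es"
  shows "decode x0 T k W (erase (map2 (\<noteq>) xs (W (reveal xs cs))) es) = reveal xs cs"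
  unfolding decode_def
  by (rule some_equality) (use assms in \<open>auto simp: decoding_error_def Let_def\<close>)

text \<open>
  The output if the decoder knew the message. The nested form exhibits it as the result of feeding
  \<open>xs\<close> through three memoryless stages.
\<close>

definition ideal_output :: "bool list \<Rightarrow> bool list \<Rightarrow> bool list \<Rightarrow> bool list \<Rightarrow> bool list" where
  "ideal_output xs cs es gs =
    map2 (\<lambda>(x, b) g. if b then g else x) (map2 (\<lambda>(x, c) e. (x, e \<and> \<not> c)) (map2 Pair xs cs) es) gs"

text \<open>At an unerased position the codeword letter cancels; an erased one is filled from the
  revealed letter or, failing that, from the guess.\<close>

lemma reconstruct_eq_ideal:
  assumes "length xs = n" "length cs = n" "length es = n" "length gs = n" "length w = n"
  shows "reconstruct (erase (map2 (\<noteq>) xs w) es) w (reveal xs cs) gs = ideal_output xs cs es gs"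
  using assms
  by (intro nth_equalityI) (auto simp: reconstruct_def ideal_output_def erase_def reveal_def)

text \<open>A letter comes out wrong exactly when it is erased, not revealed and wrongly guessed:
  independent events of joint probability \<open>\<epsilon> * (1 - \<eta>) / 2\<close>. The three
  stages compose letterwise by \<open>memoryless_bind\<close>.\<close>

lemma memoryless_ideal:
  assumes "0 \<le> \<epsilon>" "\<epsilon> \<le> 1" "0 \<le> \<eta>" "\<eta> \<le> 1" "length xs = n"
  shows "do {cs \<leftarrow> replicate_pmf n (bernoulli_pmf \<eta>); es \<leftarrow> replicate_pmf n (bernoulli_pmf \<epsilon>);
      map_pmf (ideal_output xs cs es) (replicate_pmf n (bernoulli_pmf (1/2)))} =
    memoryless (BSC (\<epsilon> * (1 - \<eta>) / 2)) xs"
proof -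
  let ?G = "\<lambda>(x, b). map_pmf (\<lambda>g. if b then g else x) (bernoulli_pmf (1/2))"
  let ?E = "\<lambda>(x, c). bernoulli_pmf \<epsilon> \<bind> (\<lambda>e. ?G (x, e \<and> \<not> c))"
  have BSC: "bernoulli_pmf \<eta> \<bind> (\<lambda>c. ?E (x, c)) = BSC (\<epsilon> * (1 - \<eta>) / 2) x" for x
  proof (rule pmf_eqI)
    fix y
    have p: "0 \<le> \<epsilon> * (1 - \<eta>) / 2" "\<epsilon> * (1 - \<eta>) / 2 \<le> 1"
      using assms mult_le_one[of \<epsilon> "1 - \<eta>"] by auto
    have pm: "pmf (map_pmf f (bernoulli_pmf q)) z =
        (if f True = z then q else 0) + (if f False = z then 1 - q else 0)"
      if "0 \<le> q" "q \<le> 1" for f :: "bool \<Rightarrow> bool" and q z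
      using that by (simp add: map_pmf_def pmf_bind indicator_def)
    show "pmf (bernoulli_pmf \<eta> \<bind> (\<lambda>c. ?E (x, c))) y = pmf (BSC (\<epsilon> * (1 - \<eta>) / 2) x) y"
      using assms(1-4) p by (cases x; cases y) (simp_all add: BSC_def pmf_bind pm field_simps)
  qed
  have G: "map_pmf (map2 (\<lambda>(x, b) g. if b then g else x) zs) (replicate_pmf n (bernoulli_pmf (1/2))) =
      memoryless ?G zs" if "length zs = n" for zs :: "(bool \<times> bool) list"
    using memoryless_map[of "\<lambda>(x, b) g. if b then g else x" "bernoulli_pmf (1/2)" zs] that
    by (simp add: case_prod_unfold)
  have E: "replicate_pmf n (bernoulli_pmf \<epsilon>) \<bind> (\<lambda>es. memoryless ?G (map2 (\<lambda>(x, c) e. (x, e \<and> \<not> c)) zs es)) =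
      memoryless ?E zs" if "length zs = n" for zs :: "(bool \<times> bool) list"
    using memoryless_bind[of zs "bernoulli_pmf \<epsilon>" ?G "\<lambda>(x, c) e. (x, e \<and> \<not> c)"] that
    by (simp add: case_prod_unfold)
  have "do {cs \<leftarrow> replicate_pmf n (bernoulli_pmf \<eta>); es \<leftarrow> replicate_pmf n (bernoulli_pmf \<epsilon>);
      map_pmf (ideal_output xs cs es) (replicate_pmf n (bernoulli_pmf (1/2)))} =
    do {cs \<leftarrow> replicate_pmf n (bernoulli_pmf \<eta>); es \<leftarrow> replicate_pmf n (bernoulli_pmf \<epsilon>);
      memoryless ?G (map2 (\<lambda>(x, c) e. (x, e \<and> \<not> c)) (map2 Pair xs cs) es)}"
    using assms(5) unfolding ideal_output_def
    by (intro bind_pmf_cong refl G) (auto dest!: length_replicate_pmf)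
  also have "\<dots> = replicate_pmf n (bernoulli_pmf \<eta>) \<bind> (\<lambda>cs. memoryless ?E (map2 Pair xs cs))"
    using assms(5) by (intro bind_pmf_cong refl E) (auto dest!: length_replicate_pmf)
  also have "\<dots> = memoryless (\<lambda>x. bernoulli_pmf \<eta> \<bind> (\<lambda>c. ?E (x, c))) xs"
    using memoryless_bind[of xs "bernoulli_pmf \<eta>" ?E Pair] assms(5) by simp
  finally show ?thesis by (simp only: BSC)
qed

lemma shared_randomness_0: "shared_randomness n 0 = {1}"
  by (simp add: shared_randomness_def)

text \<open>The encoder draws \<open>cs\<close> and the decoder draws \<open>gs\<close> privately,
  so nothing random is shared. Real and ideal outputs are functions of one sample and agree almost
  surely unless decoding fails; \<open>tv_dist_coupling\<close> turns the error probability into the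
  simulation error.\<close>

lemma code_of_codebook:
  fixes W :: "bool option list \<Rightarrow> bool list"
  assumes \<epsilon>: "0 \<le> \<epsilon>" "\<epsilon> \<le> 1" and \<eta>: "0 \<le> \<eta>" "\<eta> \<le> 1"
    and W: "\<And>v. length v = n \<Longrightarrow> length (W v) = n"
    and err: "measure_pmf.prob (pair_pmf (replicate_pmf n (bernoulli_pmf \<epsilon>))
        (pair_pmf (replicate_pmf n P) (replicate_pmf n (bernoulli_pmf \<eta>))))
        {(es, xs, cs). decoding_error x0 T k W xs cs es} \<le> \<delta>"
  shows "\<exists>enc dec. avg_simulation_code P (BSC (\<epsilon> * (1 - \<eta>) / 2)) (BEC \<epsilon>) n 0 \<delta> enc dec"
proof -
  define Xs where "Xs = replicate_pmf n P"
  define Cs where "Cs = replicate_pmf n (bernoulli_pmf \<eta>)"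
  define Es where "Es = replicate_pmf n (bernoulli_pmf \<epsilon>)"
  define Gs where "Gs = replicate_pmf n (bernoulli_pmf (1/2))"
  define Q where "Q = pair_pmf Xs (pair_pmf Cs (pair_pmf Es Gs))"
  define word where "word = (\<lambda>xs cs. map2 (\<noteq>) xs (W (reveal xs cs)))"
  define out where "out = (\<lambda>yts gs. let v = decode x0 T k W yts in reconstruct yts (W v) v gs)"
  define enc where "enc = (\<lambda>xs (\<omega>::nat). map_pmf (word xs) Cs)"
  define dec where "dec = (\<lambda>yts (\<omega>::nat). map_pmf (out yts) Gs)"
  let ?real = "\<lambda>(xs, cs, es, gs). (xs, out (erase (word xs cs) es) gs)"
  let ?ideal = "\<lambda>(xs, cs, es, gs). (xs, ideal_output xs cs es gs)"
  have len: "xs \<in> set_pmf Xs \<Longrightarrow> length xs = n" "cs \<in> set_pmf Cs \<Longrightarrow> length cs = n"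
    "es \<in> set_pmf Es \<Longrightarrow> length es = n" "gs \<in> set_pmf Gs \<Longrightarrow> length gs = n" for xs cs es gs
    by (auto simp: Xs_def Cs_def Es_def Gs_def dest: length_replicate_pmf)
  have length_word: "length (word xs cs) = n" if "length xs = n" "length cs = n" for xs cs
    using that W by (simp add: word_def)
  have BEC: "memoryless (BEC \<epsilon>) xts = map_pmf (erase xts) Es" if "length xts = n" for xts
    using memoryless_map[of "\<lambda>x e. if e then None else Some x" "bernoulli_pmf \<epsilon>" xts] that
    by (simp add: BEC_def[abs_def] Es_def erase_def[abs_def])
  have induced: "induced_dist P (BEC \<epsilon>) n 0 enc dec = map_pmf ?real Q"
  proof -
    have "induced_dist P (BEC \<epsilon>) n 0 enc dec =
      do {xs \<leftarrow> Xs; cs \<leftarrow> Cs; yts \<leftarrow> memoryless (BEC \<epsilon>) (word xs cs); gs \<leftarrow> Gs; return_pmf (xs, out yts gs)}"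
      by (simp add: induced_dist_def shared_randomness_0 pmf_of_set_singleton bind_return_pmf
        enc_def dec_def bind_map_pmf Xs_def)
    also have "\<dots> = do {xs \<leftarrow> Xs; cs \<leftarrow> Cs; es \<leftarrow> Es; gs \<leftarrow> Gs; return_pmf (xs, out (erase (word xs cs) es) gs)}"
      by (intro bind_pmf_cong refl) (simp add: BEC length_word len bind_map_pmf)
    also have "\<dots> = map_pmf ?real Q"
      by (simp add: Q_def pair_pmf_def map_bind_pmf bind_assoc_pmf bind_return_pmf)
    finally show ?thesis .
  qed
  have target: "target_dist P (BSC (\<epsilon> * (1 - \<eta>) / 2)) n = map_pmf ?ideal Q"
  proof -
    have "target_dist P (BSC (\<epsilon> * (1 - \<eta>) / 2)) n =
      do {xs \<leftarrow> Xs; ys \<leftarrow> do {cs \<leftarrow> Cs; es \<leftarrow> Es; map_pmf (ideal_output xs cs es) Gs}; return_pmf (xs, ys)}"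
      unfolding target_dist_def Xs_def[symmetric]
      by (intro bind_pmf_cong refl) (simp add: memoryless_ideal[OF \<epsilon> \<eta>] len Cs_def Es_def Gs_def)
    also have "\<dots> = map_pmf ?ideal Q"
      by (simp add: Q_def pair_pmf_def map_bind_pmf bind_assoc_pmf bind_return_pmf bind_map_pmf)
    finally show ?thesis .
  qed
  have "measure_pmf.prob Q {q. ?real q \<noteq> ?ideal q} \<le>
      measure_pmf.prob Q {(xs, cs, es, gs). decoding_error x0 T k W xs cs es}"
  proof (rule measure_pmf.finite_measure_mono_AE)
    show "AE q in Q. q \<in> {q. ?real q \<noteq> ?ideal q} \<longrightarrow>
        q \<in> {(xs, cs, es, gs). decoding_error x0 T k W xs cs es}"
      unfolding AE_measure_pmf_iff
    proof (intro ballI impI)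
      fix q assume q: "q \<in> set_pmf Q" "q \<in> {q. ?real q \<noteq> ?ideal q}"
      obtain xs cs es gs where q': "q = (xs, cs, es, gs)" by (metis surj_pair)
      have l: "length xs = n" "length cs = n" "length es = n" "length gs = n"
        using q(1) len by (auto simp: q' Q_def)
      have "?real q = ?ideal q" if "\<not> decoding_error x0 T k W xs cs es"
        using decode_eq_reveal[OF that] reconstruct_eq_ideal[OF l] W l
        by (simp add: q' out_def word_def)
      then show "q \<in> {(xs, cs, es, gs). decoding_error x0 T k W xs cs es}"
        using q(2) by (auto simp: q')
    qed
  qed simp
  also have "\<dots> = measure_pmf.prob (map_pmf (\<lambda>(xs, cs, es, gs). (es, xs, cs)) Q)
      {(es, xs, cs). decoding_error x0 T k W xs cs es}"
    by (simp add: vimage_def case_prod_unfold)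
  \<comment> \<open>The error event does not involve the guesses, which are integrated out.\<close>
  also have "map_pmf (\<lambda>(xs, cs, es, gs). (es, xs, cs)) Q = pair_pmf Es (pair_pmf Xs Cs)"
  proof -
    have "map_pmf (\<lambda>(xs, cs, es, gs). (es, xs, cs)) Q = do {xs \<leftarrow> Xs; cs \<leftarrow> Cs; es \<leftarrow> Es; return_pmf (es, xs, cs)}"
      by (simp add: Q_def pair_pmf_def map_bind_pmf bind_assoc_pmf bind_return_pmf)
    also have "\<dots> = do {xs \<leftarrow> Xs; es \<leftarrow> Es; cs \<leftarrow> Cs; return_pmf (es, xs, cs)}"
      by (subst (2) bind_commute_pmf) simp
    also have "\<dots> = do {es \<leftarrow> Es; xs \<leftarrow> Xs; cs \<leftarrow> Cs; return_pmf (es, xs, cs)}"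
      by (rule bind_commute_pmf)
    also have "\<dots> = pair_pmf Es (pair_pmf Xs Cs)"
      by (simp add: pair_pmf_def bind_assoc_pmf bind_return_pmf)
    finally show ?thesis .
  qed
  also have "measure_pmf.prob (pair_pmf Es (pair_pmf Xs Cs)) {(es, xs, cs). decoding_error x0 T k W xs cs es} \<le> \<delta>"
    using err by (simp add: Es_def Xs_def Cs_def)
  finally have "tv_dist (induced_dist P (BEC \<epsilon>) n 0 enc dec) (target_dist P (BSC (\<epsilon> * (1 - \<eta>) / 2)) n) \<le> \<delta>"
    unfolding induced target using tv_dist_coupling[of ?real Q ?ideal] by linarith
  moreover have "set_pmf (enc xs \<omega>) \<subseteq> {xts. length xts = n}" if "length xs = n" for xs \<omega>
    using that len length_word by (auto simp: enc_def)
  moreover have "set_pmf (dec yts \<omega>) \<subseteq> {ys. length ys = n}" if "length yts = n" for yts \<omega>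
    using that by (auto simp: dec_def out_def reconstruct_def Let_def)
  ultimately have "avg_simulation_code P (BSC (\<epsilon> * (1 - \<eta>) / 2)) (BEC \<epsilon>) n 0 \<delta> enc dec"
    by (simp add: avg_simulation_code_def)
  then show ?thesis by blast
qed

section \<open>Choice of the codebook and of the parameters\<close>

lemma exists_code:
  fixes P :: "bool pmf"
  assumes \<epsilon>: "0 \<le> \<epsilon>" "\<epsilon> \<le> 1" and \<eta>: "0 \<le> \<eta>" "\<eta> \<le> 1" and "n > 0" "s \<ge> 0" "t \<ge> 0"
    and gap: "(1 - \<epsilon>) * pmf P (\<not> x0) + t = k" "k = (1 - \<epsilon>) / 2 - t"
    and card: "real (card (sparse n (\<eta> + s) :: bool option list set)) \<le> exp (real n * t\<^sup>2)"
  shows "\<exists>enc dec. avg_simulation_code P (BSC (\<epsilon> * (1 - \<eta>) / 2)) (BEC \<epsilon>) n 0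
    (exp (- real n * t\<^sup>2) + exp (- 2 * real n * t\<^sup>2) + exp (- 2 * real n * s\<^sup>2)) enc dec"
proof -
  define U where "U = replicate_pmf n (bernoulli_pmf (1/2))"
  define A where "A = {v :: bool option list. length v = n}"
  define T where "T = (sparse n (\<eta> + s) :: bool option list set)"
  define \<delta> where "\<delta> = exp (- real n * t\<^sup>2) + exp (- 2 * real n * t\<^sup>2) + exp (- 2 * real n * s\<^sup>2)"
  let ?C = "Pi_pmf A [] (\<lambda>_. U)"
  let ?Es = "replicate_pmf n (bernoulli_pmf \<epsilon>)"
  let ?S = "pair_pmf (replicate_pmf n P) (replicate_pmf n (bernoulli_pmf \<eta>))"
  let ?B = "{(W, es, xs, cs). decoding_error x0 T (real n * k) W xs cs es}"
  \<comment> \<open>The number of sparse messages uses up only half of the exponent available for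
    each wrong codeword.\<close>
  have "real (card T) * exp (- 2 * real n * t\<^sup>2) \<le> exp (real n * t\<^sup>2) * exp (- 2 * real n * t\<^sup>2)"
    using card by (intro mult_right_mono) (simp_all add: T_def)
  also have "\<dots> = exp (- real n * t\<^sup>2)" by (simp flip: exp_add)
  finally have "real (card T) * exp (- 2 * real n * t\<^sup>2) + exp (- 2 * real n * t\<^sup>2) + exp (- 2 * real n * s\<^sup>2) \<le> \<delta>"
    by (simp add: \<delta>_def)
  with prob_decoding_error_le[OF assms(1-9), of "[]"]
  have "measure_pmf.prob (pair_pmf (pair_pmf ?C ?Es) ?S)
      {((W, es), (xs, cs)). decoding_error x0 T (real n * k) W xs cs es} \<le> \<delta>"
    unfolding A_def U_def T_def by linarith
  \<comment> \<open>Reassociating separates the codebook from all other randomness, so that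
    averaging over it yields one good codebook.\<close>
  then have "measure_pmf.prob (pair_pmf ?C (pair_pmf ?Es ?S)) ?B \<le> \<delta>"
    by (simp add: pair_pair_pmf vimage_def case_prod_unfold)
  then obtain W where W: "W \<in> set_pmf ?C"
    and err: "measure_pmf.prob (pair_pmf ?Es ?S) {b. (W, b) \<in> ?B} \<le> \<delta>"
    using exists_prob_le_prob_pair_pmf[of ?C "pair_pmf ?Es ?S" ?B] by (auto intro: order_trans)
  have finA: "finite A"
    using finite_lists_length_eq[of "UNIV :: bool option set" n] by (simp add: A_def)
  have "length (W v) = n" if "length v = n" for v
    using W that finA length_replicate_pmf[of "W v" n]
    by (auto simp: set_Pi_pmf PiE_dflt_def U_def A_def)
  then show ?thesis
    using code_of_codebook[OF \<epsilon> \<eta>, of n W P x0 T "real n * k" \<delta>] err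
    by (simp add: \<delta>_def)
qed

lemma nonuniform_bool_pmf:
  fixes P :: "bool pmf"
  assumes "P \<noteq> pmf_of_set UNIV"
  shows "\<exists>x0. pmf P (\<not> x0) < 1 / 2"
proof (rule ccontr)
  assume "\<not> ?thesis"
  then have "\<not> pmf P (\<not> (\<not> b)) < 1 / 2" for b
    by blast
  then have ge: "1 / 2 \<le> pmf P b" for b
    by (simp add: not_less)
  have "pmf P True + pmf P False = sum (pmf P) UNIV" by (simp add: UNIV_bool)
  also have "\<dots> = 1" by (rule sum_pmf_eq_1) auto
  finally have "pmf P True = 1 / 2"
    using ge[of True] ge[of False] by linarith
  then have "P = bernoulli_pmf (1 / 2)"
    using bool_pmf_eq_bernoulli[of P] by metis
  then show False using assms by (simp add: bernoulli_pmf_half_conv_pmf_of_set)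
qed

theorem theorem5:
  fixes \<epsilon> :: real and P :: "bool pmf"
  assumes "0 < \<epsilon>" and "\<epsilon> < 1"
    and "P \<noteq> pmf_of_set UNIV"
  shows "\<exists>p\<ge>0. p < \<epsilon> / 2 \<and> avg_admissible P (BSC p) (BEC \<epsilon>) 0"
proof -
  obtain x0 where x0: "pmf P (\<not> x0) < 1 / 2"
    using nonuniform_bool_pmf[OF assms(3)] ..
  \<comment> \<open>Half the gap between the two mean mismatch rates, so that the threshold lies
    midway between them.\<close>
  define t where "t = (1 - \<epsilon>) * (1 / 2 - pmf P (\<not> x0)) / 2"
  have "t > 0" using assms x0 by (simp add: t_def)
  \<comment> \<open>The counting lemma is applied with \<open>c = t\<^sup>2\<close>, which must not
    exceed 1.\<close>
  moreover have "(1 - \<epsilon>) * (1 / 2 - pmf P (\<not> x0)) \<le> 1"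
    using assms x0 pmf_nonneg[of P "\<not> x0"] by (intro mult_le_one) linarith+
  then have "t \<le> 1 / 2" unfolding t_def by (rule divide_right_mono) simp
  then have "t \<le> 1" by simp
  ultimately obtain \<theta> where \<theta>: "\<theta> > 0" "\<theta> < 2"
    and card: "\<And>n. real (card (sparse n \<theta> :: bool option list set)) \<le> exp (real n * t\<^sup>2)"
    using exists_small_sparse[of "t\<^sup>2"] by (auto simp: power_le_one)
  \<comment> \<open>The sparsity level \<open>\<theta>\<close> is split equally:
    \<open>\<eta>\<close> is both the probability of revealing a letter and the slack
    \<open>s\<close> in the tail bound. Its positivity puts the crossover probability strictly below
    \<open>\<epsilon> / 2\<close>.\<close>
  define \<eta> where "\<eta> = \<theta> / 2"
  have \<eta>: "0 < \<eta>" "\<eta> < 1" "\<eta> + \<eta> = \<theta>" using \<theta> by (auto simp: \<eta>_def)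
  define \<delta> where "\<delta> = (\<lambda>n. exp (- real n * t\<^sup>2) + exp (- 2 * real n * t\<^sup>2) + exp (- 2 * real n * \<eta>\<^sup>2))"
  have lim: "(\<lambda>n. exp (- real n * c)) \<longlonglongrightarrow> 0" if "c > 0" for c
    using that by real_asymp
  have "\<delta> \<longlonglongrightarrow> 0 + 0 + 0"
    unfolding \<delta>_def
    using lim[of "t\<^sup>2"] lim[of "2 * t\<^sup>2"] lim[of "2 * \<eta>\<^sup>2"] \<open>t > 0\<close> \<eta>
    by (intro tendsto_add) (simp_all add: mult_ac)
  moreover have "\<exists>enc dec. avg_simulation_code P (BSC (\<epsilon> * (1 - \<eta>) / 2)) (BEC \<epsilon>) n 0 (\<delta> n) enc dec"
    if "n \<ge> 1" for n
    unfolding \<delta>_def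
    using assms \<eta> \<open>t > 0\<close> that card[of n]
    \<comment> \<open>Here \<open>refl\<close> sets the threshold \<open>k\<close> to the mean rate
      of the true codeword plus \<open>t\<close>; the definition of \<open>t\<close> gives the
      second equation for \<open>k\<close>.\<close>
    by (intro exists_code[where ?x0.0 = x0, OF _ _ _ _ _ _ _ refl]) (auto simp: t_def field_simps)
  ultimately have "avg_admissible P (BSC (\<epsilon> * (1 - \<eta>) / 2)) (BEC \<epsilon>) 0"
    unfolding avg_admissible_def by auto
  moreover have "0 \<le> \<epsilon> * (1 - \<eta>) / 2" "\<epsilon> * (1 - \<eta>) / 2 < \<epsilon> / 2"
    using assms \<eta> by (auto simp: algebra_simps)
  ultimately show ?thesis by blast
qed

end
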